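(* Let $\mathcal{G}=(V':V'',E)$ be a bipartite $\Delta$-regular undirected connected graph with $|V'|=|V''|=n>1$, let $F=\mathrm{GF}(q)$, and let $\mathcal{C}'$ and $\mathcal{C}''$ be linear $[\Delta,r\Delta,\theta\Delta]$ and $[\Delta,R\Delta,\delta\Delta]$ codes over $F$, respectively. Let $\mathsf{C}=(\mathcal{G},\mathcal{C}':\mathcal{C}'')$ and let $(\mathsf{C})_\Phi$ be the associated code of length $n$ over $\Phi=F^{r\Delta}$. Then the relative minimum distance of $(\mathsf{C})_\Phi$ is bounded from below by $$\frac{\delta-\gamma_{\mathcal{G}}\sqrt{\delta/\theta}}{1-\gamma_{\mathcal{G}}}.$$ In particular, this lower bound approaches $\delta$ when $\gamma_{\mathcal{G}}\to 0$.
   Context: Graphs are simple; $V=V'\cup V''$ with $V'\cap V''=\emptyset$ and every edge has one endpoint in $V'$ and one in $V''$. For a vertex $u$, $E(u)$ is the set of edges incident with $u$; an ordering of $V$ is fixed, which induces an ordering of each $E(u)$. For a word $z=(z_e)_{e\in E}$, $(z)_{E(u)}$ denotes the sub-block of $z$ indexed by $E(u)$ (a word of length $\Delta$). The number $\gamma_{\mathcal{G}}$ is the ratio between the second largest eigenvalue (counted with multiplicity) of the $2n\times 2n$ 0/1 adjacency matrix of $\mathcal{G}$ and $\Delta$ (its largest eigenvalue); for connected $\mathcal{G}$ with $n>1$ one has $0\le\gamma_{\mathcal{G}}<1$. A linear $[N,k,d]$ code over $F$ is a $k$-dimensional subspace of $F^N$ with minimum Hamming distance $d$ (so here $k,d\ge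 1$). The code $\mathsf{C}=(\mathcal{G},\mathcal{C}':\mathcal{C}'')$ is $$\mathsf{C}=\{c\in F^{|E|}: (c)_{E(u)}\in\mathcal{C}'\text{ for every }u\in V'\text{ and }(c)_{E(v)}\in\mathcal{C}''\text{ for every }v\in V''\}.$$ Let $\Phi=F^{r\Delta}$, fix a linear one-to-one map $\mathcal{E}:\Phi\to\mathcal{C}'$ over $F$ (hence a bijection), and define $\psi_{\mathcal{E}}:\mathsf{C}\to\Phi^n$ by $\psi_{\mathcal{E}}(c)=\bigl(\mathcal{E}^{-1}((c)_{E(u)})\bigr)_{u\in V'}$. Then $(\mathsf{C})_\Phi=\{\psi_{\mathcal{E}}(c):c\in\mathsf{C}\}\subseteq\Phi^n$. The relative minimum distance of $(\mathsf{C})_\Phi$ is $1/n$ times the minimum Hamming distance over $\Phi$ (number of $u\in V'$ at which entries differ) between two distinct codewords (the statement is vacuous if $(\mathsf{C})_\Phi$ has only one codeword). *)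

theory Defs
  imports
    Complex_Main
    "HOL-Library.FuncSet"
    "HOL-Computational_Algebra.Polynomial"
    "Jordan_Normal_Form.Char_Poly"
    "Jordan_Normal_Form.VS_Connect"
begin

text \<open>
  A simple undirected graph is given by its vertex set and its set \<open>E\<close> of edges, an edge being the
  two-element set of its endpoints. The fixed ordering of the vertices is the linear order of the
  vertex type.
\<close>

definition bipartite_graph :: "'v set \<Rightarrow> 'v set \<Rightarrow> 'v set set \<Rightarrow> bool" where
  "bipartite_graph V' V'' E \<longleftrightarrow>
     finite V' \<and> finite V'' \<and> V' \<inter> V'' = {} \<and> (\<forall>e\<in>E. \<exists>u\<in>V'. \<exists>v\<in>V''. e = {u, v})"

definition incident_edges :: "'v set set \<Rightarrow> 'v \<Rightarrow> 'v set set" where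
  "incident_edges E u = {e \<in> E. u \<in> e}"

definition regular_graph :: "'v set \<Rightarrow> 'v set set \<Rightarrow> nat \<Rightarrow> bool" where
  "regular_graph V E \<Delta> \<longleftrightarrow> (\<forall>u\<in>V. card (incident_edges E u) = \<Delta>)"

definition connected_graph :: "'v set \<Rightarrow> 'v set set \<Rightarrow> bool" where
  "connected_graph V E \<longleftrightarrow> V \<noteq> {} \<and> (\<forall>u\<in>V. \<forall>v\<in>V. (u, v) \<in> {(x, y). {x, y} \<in> E}\<^sup>*)"

definition adjacency_mat :: "'v::linorder set \<Rightarrow> 'v set set \<Rightarrow> real mat" where
  "adjacency_mat V E =
     mat (card V) (card V)
       (\<lambda>(i, j). if {sorted_list_of_set V ! i, sorted_list_of_set V ! j} \<in> E then 1 else 0)"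

text \<open>
  The eigenvalues of a real matrix, repeated according to (algebraic) multiplicity, in descending
  order. For a symmetric matrix all complex eigenvalues are real, so none is lost.
\<close>

definition eigenvalues_desc :: "real mat \<Rightarrow> real list" where
  "eigenvalues_desc A = rev (sorted_list_of_multiset (proots (char_poly A)))"

definition graph_gamma :: "'v::linorder set \<Rightarrow> 'v set set \<Rightarrow> nat \<Rightarrow> real" where
  "graph_gamma V E \<Delta> = eigenvalues_desc (adjacency_mat V E) ! 1 / real \<Delta>"

definition hamming_dist :: "'i set \<Rightarrow> ('i \<Rightarrow> 'a) \<Rightarrow> ('i \<Rightarrow> 'a) \<Rightarrow> nat" where
  "hamming_dist I x y = card {i \<in> I. x i \<noteq> y i}"

text \<open>
  The minimum of \<open>d\<close> over pairs of distinct elements of \<open>C\<close>; it is meaningful only if \<open>C\<close> has at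
  least two elements, since the infimum of the empty set of naturals is \<open>0\<close>.
\<close>

definition min_distance :: "('a \<Rightarrow> 'a \<Rightarrow> nat) \<Rightarrow> 'a set \<Rightarrow> nat" where
  "min_distance d C = Inf {d x y | x y. x \<in> C \<and> y \<in> C \<and> x \<noteq> y}"

abbreviation code_space :: "nat \<Rightarrow> 'f::field vec set \<Rightarrow> ('f, 'f vec) module" where
  "code_space N C \<equiv> module_vec TYPE('f) N\<lparr>carrier := C\<rparr>"

definition linear_code :: "nat \<Rightarrow> nat \<Rightarrow> nat \<Rightarrow> 'f::field vec set \<Rightarrow> bool" where
  "linear_code N k d C \<longleftrightarrow>
     VectorSpace.subspace class_ring C (module_vec TYPE('f) N) \<and>
     1 \<le> k \<and> vectorspace.dim class_ring (code_space N C) = k \<and>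
     1 \<le> d \<and> min_distance (\<lambda>x y. hamming_dist {..<N} (($) x) (($) y)) C = d"

text \<open>
  The sub-block of a word \<open>z\<close> (indexed by edges) at the edges incident with \<open>u\<close>. These edges
  are the \<open>{u, v}\<close> with \<open>v\<close> a neighbour of \<open>u\<close>, and are ordered by \<open>v\<close>.
\<close>

definition sub_block :: "'v::linorder set set \<Rightarrow> ('v set \<Rightarrow> 'f) \<Rightarrow> 'v \<Rightarrow> 'f vec" where
  "sub_block E z u =
     vec_of_list (map (\<lambda>v. z {u, v}) (sorted_list_of_set {v. {u, v} \<in> E}))"

definition graph_code ::
  "'v::linorder set \<Rightarrow> 'v set \<Rightarrow> 'v set set \<Rightarrow> 'f vec set \<Rightarrow> 'f vec set \<Rightarrow> ('v set \<Rightarrow> 'f) set" where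
  "graph_code V' V'' E C' C'' =
     {c \<in> E \<rightarrow>\<^sub>E UNIV. (\<forall>u\<in>V'. sub_block E c u \<in> C') \<and> (\<forall>v\<in>V''. sub_block E c v \<in> C'')}"

text \<open>
  With \<open>\<Phi>\<close> the space of vectors of length \<open>k\<close>, elements of \<open>\<Phi>\<^sup>n\<close> are represented
  as words indexed by \<open>V'\<close>, and \<open>enc\<close> is the encoder of \<open>\<Phi>\<close> into the code used at \<open>V'\<close>.
\<close>

definition psi ::
  "'v::linorder set \<Rightarrow> 'v set set \<Rightarrow> nat \<Rightarrow> ('f vec \<Rightarrow> 'f vec) \<Rightarrow> ('v set \<Rightarrow> 'f) \<Rightarrow> 'v \<Rightarrow> 'f vec" where
  "psi V' E k enc c = (\<lambda>u\<in>V'. the_inv_into (carrier_vec k) enc (sub_block E c u))"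

definition graph_code_Phi ::
  "'v::linorder set \<Rightarrow> 'v set \<Rightarrow> 'v set set \<Rightarrow> 'f vec set \<Rightarrow> 'f vec set \<Rightarrow> nat \<Rightarrow>
   ('f vec \<Rightarrow> 'f vec) \<Rightarrow> ('v \<Rightarrow> 'f vec) set" where
  "graph_code_Phi V' V'' E C' C'' k enc = psi V' E k enc ` graph_code V' V'' E C' C''"

definition rel_min_distance :: "'i set \<Rightarrow> ('i \<Rightarrow> 'a) set \<Rightarrow> real" where
  "rel_min_distance I C = real (min_distance (hamming_dist I) C) / real (card I)"

end

theory Submission
  imports Defs "Jordan_Normal_Form.Schur_Decomposition"
begin

text \<open>
  Let \<open>c\<close> and \<open>c'\<close> be two codewords, let \<open>S \<subseteq> V'\<close> and \<open>T \<subseteq> V''\<close> be the sets of vertices at which their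
  sub-blocks differ, and let \<open>\<sigma> = |S|/n\<close>, \<open>\<tau> = |T|/n\<close>. The edges on which \<open>c\<close> and \<open>c'\<close> differ all run
  between \<open>S\<close> and \<open>T\<close>, and there are at least \<open>\<theta>\<Delta>|S|\<close> and at least \<open>\<delta>\<Delta>|T|\<close> of them. The expander
  mixing lemma bounds the number of edges between \<open>S\<close> and \<open>T\<close> by
  \<open>\<Delta>n((1 - \<gamma>)\<sigma>\<tau> + \<gamma>\<surd>(\<sigma>\<tau>))\<close>, so both \<open>\<theta>\<sigma>\<close> and \<open>\<delta>\<tau>\<close> are at most
  \<open>(1 - \<gamma>)\<sigma>\<tau> + \<gamma>\<surd>(\<sigma>\<tau>)\<close>. The second inequality gives the claim if \<open>\<theta>\<sigma> \<le> \<delta>\<tau>\<close>, the first one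
  otherwise.

  The mixing lemma rests on \<open>f\<^sup>T A f \<le> \<gamma>\<Delta>\<parallel>f\<parallel>\<^sup>2\<close> for all \<open>f\<close> orthogonal to the constants, where \<open>A\<close>
  is the adjacency matrix. This follows by diagonalizing \<open>A\<close> in an orthonormal basis, once the Laplacian
  and connectedness show that the eigenvalue \<open>\<Delta>\<close> is simple.
\<close>

section \<open>Spectral theorem for real symmetric matrices\<close>

lemma symmetric_sprod:
  fixes A :: "'a::comm_semiring_0 mat"
  assumes A: "A \<in> carrier_mat n n" and sym: "transpose_mat A = A"
    and x: "x \<in> carrier_vec n" and y: "y \<in> carrier_vec n"
  shows "(A *\<^sub>v x) \<bullet> y = x \<bullet> (A *\<^sub>v y)"
  using transpose_vec_mult_scalar[OF A x y] sym
  by (metis A mult_mat_vec_carrier comm_scalar_prod x y)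

text \<open>Pair the eigenvector equation with the conjugate of \<open>v\<close>. Moving the
  symmetric matrix to the other factor replaces \<open>z\<close> by \<open>cnj z\<close>, and
  \<open>v \<bullet>c v\<close> is nonzero.\<close>

lemma symmetric_eigenvalue_real:
  fixes A :: "real mat"
  assumes A: "A \<in> carrier_mat n n" and sym: "transpose_mat A = A"
    and ev: "eigenvalue (map_mat complex_of_real A) z"
  shows "z \<in> \<real>"
proof -
  let ?A = "map_mat complex_of_real A"
  have A': "?A \<in> carrier_mat n n" using A by auto
  have sym': "transpose_mat ?A = ?A" using sym by (metis map_mat_transpose)
  obtain v where v: "v \<in> carrier_vec n" "v \<noteq> 0\<^sub>v n" "?A *\<^sub>v v = z \<cdot>\<^sub>v v"
    using ev A unfolding eigenvalue_def eigenvector_def by auto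
  have cv: "conjugate v \<in> carrier_vec n" using v by auto
  have "?A *\<^sub>v conjugate v = conjugate (?A *\<^sub>v v)"
    using A v(1) by (intro eq_vecI) (auto simp: scalar_prod_def)
  then have Acv: "?A *\<^sub>v conjugate v = cnj z \<cdot>\<^sub>v conjugate v"
    using v(3) by (simp add: conjugate_smult_vec)
  have "z * (v \<bullet>c v) = (?A *\<^sub>v v) \<bullet> conjugate v" using v cv by simp
  also have "\<dots> = v \<bullet> (?A *\<^sub>v conjugate v)" by (rule symmetric_sprod[OF A' sym' v(1) cv])
  also have "\<dots> = cnj z * (v \<bullet>c v)" unfolding Acv using v cv by simp
  finally show ?thesis using v(1,2) by (simp add: Reals_cnj_iff)
qed

text \<open>Over the complex numbers the polynomial splits. Its roots are eigenvalues, hence real,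
  and the factorization pulls back because the embedding of polynomials is injective.\<close>

lemma symmetric_char_poly_splits:
  fixes A :: "real mat"
  assumes A: "A \<in> carrier_mat n n" and sym: "transpose_mat A = A"
  obtains rs where "char_poly A = (\<Prod>r\<leftarrow>rs. [:- r, 1:])"
proof -
  let ?A = "map_mat complex_of_real A"
  have A': "?A \<in> carrier_mat n n" using A by auto
  obtain zs where zs: "char_poly ?A = (\<Prod>z\<leftarrow>zs. [:- z, 1:])"
    using char_poly_factorized[OF A'] by blast
  have "z \<in> \<real>" if "z \<in> set zs" for z
  proof (rule symmetric_eigenvalue_real[OF A sym])
    show "eigenvalue ?A z"
      using that unfolding eigenvalue_root_char_poly[OF A'] zs
      by (auto simp: poly_prod_list prod_list_zero_iff image_iff intro!: bexI[of _ z])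
  qed
  then have zs': "zs = map of_real (map Re zs)" by (simp add: map_idI)
  interpret h: map_poly_inj_idom_hom complex_of_real ..
  have hom: "map_poly complex_of_real (\<Prod>r\<leftarrow>rs. [:- r, 1:]) =
      (\<Prod>z\<leftarrow>map of_real rs. [:- z, 1:])" for rs
  proof (induction rs)
    case (Cons r rs)
    then show ?case by (simp add: h.hom_mult del: mult_pCons_left)
  qed simp
  have "map_poly complex_of_real (char_poly A) = char_poly ?A"
    by (rule of_real_hom.char_poly_hom[OF A, symmetric])
  also have "\<dots> = map_poly complex_of_real (\<Prod>r\<leftarrow>map Re zs. [:- r, 1:])"
    unfolding zs hom zs'[symmetric] ..
  finally have "char_poly A = (\<Prod>r\<leftarrow>map Re zs. [:- r, 1:])" by (rule h.injectivity)
  then show thesis by (rule that)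
qed

text \<open>No eigenvalue is lost: since the polynomial splits, the list has full length, so for
  \<open>n \<ge> 2\<close> the entry at index 1 that \<open>graph_gamma\<close> reads
  exists.\<close>

lemma char_poly_eigenvalues_desc:
  fixes A :: "real mat"
  assumes A: "A \<in> carrier_mat n n" and sym: "transpose_mat A = A"
  shows "char_poly A = (\<Prod>r\<leftarrow>eigenvalues_desc A. [:- r, 1:])"
    and "sorted (rev (eigenvalues_desc A))" and "length (eigenvalues_desc A) = n"
proof -
  obtain rs where rs: "char_poly A = (\<Prod>r\<leftarrow>rs. [:- r, 1:])"
    using symmetric_char_poly_splits[OF A sym] .
  have "proots (\<Prod>r\<leftarrow>rs. [:- r, 1:]) = mset rs" for rs :: "real list"
  proof (induction rs)
    case (Cons r rs)
    have "(\<Prod>r\<leftarrow>rs. [:- r, 1:]) \<noteq> 0" by (auto simp: prod_list_zero_iff)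
    then have "proots ([:- r, 1:] * (\<Prod>r\<leftarrow>rs. [:- r, 1:])) = proots [:- r, 1:] + mset rs"
      using Cons by (subst proots_mult) auto
    then show ?case by (simp del: mult_pCons_left)
  qed auto
  then have "mset (eigenvalues_desc A) = mset rs" unfolding eigenvalues_desc_def rs by simp
  then show cp: "char_poly A = (\<Prod>r\<leftarrow>eigenvalues_desc A. [:- r, 1:])"
    unfolding rs by (metis mset_map prod_mset_prod_list)
  show "sorted (rev (eigenvalues_desc A))" unfolding eigenvalues_desc_def by simp
  show "length (eigenvalues_desc A) = n"
    using degree_monic_char_poly[OF A] degree_linear_factors[of uminus "eigenvalues_desc A"] cp
    by simp
qed

text \<open>Complete an eigenvector for \<open>e\<close> to a basis, orthogonalize by Gram-Schmidt,
  which keeps the first vector, and normalize. The first column of \<open>W\<close> is then still an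
  eigenvector.\<close>

lemma orthogonal_diagonalization_step:
  fixes A :: "real mat"
  assumes A: "A \<in> carrier_mat n n" and sym: "transpose_mat A = A" and ev: "eigenvalue A e"
  obtains W where "W \<in> carrier_mat n n" "transpose_mat W * W = 1\<^sub>m n"
    "col (transpose_mat W * A * W) 0 = vec n (\<lambda>i. if i = 0 then e else 0)"
proof -
  obtain v where v: "v \<in> carrier_vec n" "v \<noteq> 0\<^sub>v n" "A *\<^sub>v v = e \<cdot>\<^sub>v v"
    using ev A unfolding eigenvalue_def eigenvector_def by auto
  interpret cof_vec_space n "TYPE(real)" .
  define b where "b = basis_completion v"
  define ws where "ws = gram_schmidt n b"
  note bc = basis_completion[OF v(1,2), folded b_def]
  have n: "n \<noteq> 0" using v by (intro notI) auto
  obtain vs where bv: "b = v # vs" using bc(6,7) n by (cases b) auto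
  note gs = gram_schmidt_result[OF bc(2,4,5) refl, folded ws_def]
  have ws: "set ws \<subseteq> carrier_vec n" "corthogonal ws" "length ws = n" using gs bc(6) by auto
  have hd: "ws ! 0 = v"
    using gram_schmidt_hd[OF v(1), of vs, folded bv] ws(3) n unfolding ws_def
    by (metis hd_conv_nth length_0_conv)
  have wsc: "ws ! i \<in> carrier_vec n" if "i < n" for i using ws that by auto
  have orth: "(ws ! i \<bullet> ws ! j = 0) = (i \<noteq> j)" if "i < n" "j < n" for i j
    using corthogonalD[OF ws(2), of i j] that ws(3) by simp
  define a where "a i = 1 / sqrt (ws ! i \<bullet> ws ! i)" for i
  define w where "w i = a i \<cdot>\<^sub>v (ws ! i)" for i
  have wc: "w i \<in> carrier_vec n" if "i < n" for i using wsc[OF that] unfolding w_def by simp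
  have ww: "w i \<bullet> w j = (if i = j then 1 else 0)" if "i < n" "j < n" for i j
  proof -
    have "w i \<bullet> w j = a i * a j * (ws ! i \<bullet> ws ! j)"
      unfolding w_def using wsc[OF that(1)] wsc[OF that(2)] by simp
    moreover have "ws ! i \<bullet> ws ! i \<ge> 0"
      by (auto simp: scalar_prod_def intro!: sum_nonneg)
    ultimately show ?thesis using orth[OF that] unfolding a_def by (auto simp: field_simps)
  qed
  define W where "W = mat_of_cols n (map w [0..<n])"
  have W: "W \<in> carrier_mat n n" unfolding W_def by auto
  have colW: "col W i = w i" if "i < n" for i
    unfolding W_def using that wc[OF that] by simp
  have WW: "transpose_mat W * W = 1\<^sub>m n"
    using W by (intro eq_matI) (auto simp: colW ww)
  have Aw: "A *\<^sub>v w 0 = e \<cdot>\<^sub>v w 0"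
    unfolding w_def hd using A v by (simp add: mult_mat_vec smult_smult_assoc mult.commute)
  have "col (transpose_mat W * A * W) 0 = vec n (\<lambda>i. if i = 0 then e else 0)" (is "?l = ?r")
  proof (rule eq_vecI)
    fix i assume "i < dim_vec ?r"
    then have i: "i < n" by simp
    have "transpose_mat W * A * W = transpose_mat W * (A * W)"
      using A W by (simp add: assoc_mult_mat)
    then have "?l $ i = w i \<bullet> col (A * W) 0" using i n W A by (simp add: colW)
    also have "col (A * W) 0 = A *\<^sub>v w 0" using n by (subst col_mult2[OF A W]) (simp_all add: colW)
    also have "w i \<bullet> (A *\<^sub>v w 0) = e * (w i \<bullet> w 0)" unfolding Aw using wc[OF i] wc[of 0] n by simp
    finally show "?l $ i = ?r $ i" using i n ww by simp
  qed (use W in auto)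
  with W WW show thesis by (rule that)
qed

text \<open>Deflation, by induction on the list of roots: after one step, symmetry clears the first
  row as well as the first column, and the remaining block is symmetric with the tail of the list as
  its roots. The diagonal keeps the order of the list.\<close>

lemma symmetric_diagonalization:
  fixes A :: "real mat"
  assumes "A \<in> carrier_mat n n" and "transpose_mat A = A"
    and "char_poly A = (\<Prod>e\<leftarrow>es. [:- e, 1:])"
  shows "\<exists>P \<in> carrier_mat n n. transpose_mat P * P = 1\<^sub>m n \<and>
           transpose_mat P * A * P = mat n n (\<lambda>(i, j). if i = j then es ! i else 0)"
  using assms
proof (induction es arbitrary: n A)
  case Nil
  then have "n = 0" using degree_monic_char_poly[of A n] by auto
  then show ?case by (intro bexI[of _ "1\<^sub>m 0"]) (auto intro!: eq_matI)
next
  case (Cons e es n A)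
  note A = Cons.prems(1) and sym = Cons.prems(2)
  have cp: "char_poly A = [:-e, 1:] * (\<Prod>e\<leftarrow>es. [:- e, 1:])" using Cons.prems by simp
  have ev: "eigenvalue A e" unfolding eigenvalue_root_char_poly[OF A] cp by simp
  obtain W where W: "W \<in> carrier_mat n n" and WW: "transpose_mat W * W = 1\<^sub>m n"
    and col0: "col (transpose_mat W * A * W) 0 = vec n (\<lambda>i. if i = 0 then e else 0)"
    using orthogonal_diagonalization_step[OF A sym ev] .
  have n0: "n \<noteq> 0" using ev A unfolding eigenvalue_def eigenvector_def by (intro notI) auto
  define m where "m = n - 1"
  have n: "n = Suc m" using n0 m_def by simp
  have Wt: "transpose_mat W \<in> carrier_mat n n" using W by simp
  have WW': "W * transpose_mat W = 1\<^sub>m n" by (rule mat_mult_left_right_inverse[OF Wt W WW])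
  define A' where "A' = transpose_mat W * A * W"
  have A': "A' \<in> carrier_mat n n" unfolding A'_def using W A by auto
  have sym': "transpose_mat A' = A'"
    unfolding A'_def using W A sym
    by (simp add: transpose_mult[where nr = n and n = n and nc = n] assoc_mult_mat[where n\<^sub>1 = n and n\<^sub>2 = n and n\<^sub>3 = n and n\<^sub>4 = n])
  have sim: "similar_mat A' A" unfolding similar_mat_def
    by (intro exI[of _ "transpose_mat W"] exI[of _ W] similar_mat_witI[of _ _ n])
      (use W A A' WW WW' in \<open>auto simp: A'_def\<close>)
  define A3 where "A3 = mat m m (\<lambda>(i, j). A' $$ (Suc i, Suc j))"
  have A3: "A3 \<in> carrier_mat m m" unfolding A3_def by simp
  have A'i0: "A' $$ (i, 0) = (if i = 0 then e else 0)" if "i < n" for i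
    using arg_cong[OF col0, of "\<lambda>v. v $ i"] that A' n0 unfolding A'_def[symmetric] by simp
  have A'0i: "A' $$ (0, i) = (if i = 0 then e else 0)" if "i < n" for i
    using A'i0[OF that] sym' that A' n0 by (metis carrier_matD index_transpose_mat(1) gr0I)
  define A1 where "A1 = mat 1 1 (\<lambda>_. e)"
  have A1: "A1 \<in> carrier_mat 1 1" unfolding A1_def by simp
  have blk: "A' = four_block_mat A1 (0\<^sub>m 1 m) (0\<^sub>m m 1) A3"
    using A' A'i0 A'0i by (intro eq_matI) (auto simp: A1_def A3_def n)
  have sym3: "transpose_mat A3 = A3"
  proof (rule eq_matI)
    fix i j assume "i < dim_row A3" "j < dim_col A3"
    then show "transpose_mat A3 $$ (i, j) = A3 $$ (i, j)"
      using arg_cong[OF sym', of "\<lambda>M. M $$ (Suc i, Suc j)"] A'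
      by (simp add: A3_def n)
  qed (auto simp: A3_def)
  have "char_poly A = char_poly A'" using char_poly_similar[OF sim] by simp
  also have "\<dots> = char_poly A1 * char_poly A3"
    unfolding blk by (rule char_poly_four_block_zeros_col[OF A1 _ A3]) simp
  also have "char_poly A1 = [:-e, 1:]" by (simp add: A1_def char_poly_defs det_def sign_def)
  finally have cp3: "char_poly A3 = (\<Prod>e\<leftarrow>es. [:- e, 1:])"
    unfolding cp by (metis mult_cancel_left pCons_eq_0_iff zero_neq_one)
  obtain P3 where P3: "P3 \<in> carrier_mat m m" and PP: "transpose_mat P3 * P3 = 1\<^sub>m m"
    and D: "transpose_mat P3 * A3 * P3 = mat m m (\<lambda>(i, j). if i = j then es ! i else 0)"
    using Cons.IH[OF A3 sym3 cp3] by blast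
  \<comment> \<open>\<open>Q\<close> applies \<open>P3\<close> to the last \<open>m\<close>
    coordinates and leaves the corner entry \<open>e\<close> alone.\<close>
  define Q where "Q = four_block_mat (1\<^sub>m 1) (0\<^sub>m 1 m) (0\<^sub>m m 1) P3"
  have Q: "Q \<in> carrier_mat n n" unfolding Q_def n using P3 by (metis four_block_carrier_mat one_carrier_mat plus_1_eq_Suc)
  have Qt: "transpose_mat Q = four_block_mat (1\<^sub>m 1) (0\<^sub>m 1 m) (0\<^sub>m m 1) (transpose_mat P3)"
    unfolding Q_def using P3 by (simp add: transpose_four_block_mat[where ?nr1.0 = 1 and ?nc1.0 = 1 and ?nr2.0 = m and ?nc2.0 = m])
  have QQ: "transpose_mat Q * Q = 1\<^sub>m n"
    unfolding Qt unfolding Q_def n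
    by (subst mult_four_block_mat[where ?nr1.0 = 1 and ?n1.0 = 1 and ?n2.0 = m and ?nr2.0 = m and ?nc1.0 = 1 and ?nc2.0 = m])
      (use P3 PP in auto)
  have QAQ: "transpose_mat Q * A' * Q = four_block_mat A1 (0\<^sub>m 1 m) (0\<^sub>m m 1) (transpose_mat P3 * A3 * P3)"
    unfolding Qt blk unfolding Q_def
    by (subst mult_four_block_mat[where ?nr1.0 = 1 and ?n1.0 = 1 and ?n2.0 = m and ?nr2.0 = m and ?nc1.0 = 1 and ?nc2.0 = m];
        (subst mult_four_block_mat[where ?nr1.0 = 1 and ?n1.0 = 1 and ?n2.0 = m and ?nr2.0 = m and ?nc1.0 = 1 and ?nc2.0 = m])?)
      (use P3 A3 A1 in auto)
  have D': "transpose_mat Q * A' * Q = mat n n (\<lambda>(i, j). if i = j then (e # es) ! i else 0)"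
    unfolding QAQ D by (rule eq_matI) (auto simp: A1_def n nth_Cons split: nat.splits)
  have Qtc: "transpose_mat Q \<in> carrier_mat n n" using Q by simp
  let ?P = "W * Q"
  have P: "?P \<in> carrier_mat n n" using W Q by simp
  have Pt: "transpose_mat ?P = transpose_mat Q * transpose_mat W" by (rule transpose_mult[OF W Q])
  have "transpose_mat ?P * ?P = transpose_mat Q * ((transpose_mat W * W) * Q)"
    unfolding Pt using W Q by (simp add: assoc_mult_mat[where n\<^sub>1 = n and n\<^sub>2 = n and n\<^sub>3 = n and n\<^sub>4 = n])
  then have 1: "transpose_mat ?P * ?P = 1\<^sub>m n" using WW Q QQ by simp
  have "transpose_mat ?P * A * ?P = transpose_mat Q * A' * Q"
    unfolding Pt A'_def using W Q A by (simp add: assoc_mult_mat[where n\<^sub>1 = n and n\<^sub>2 = n and n\<^sub>3 = n and n\<^sub>4 = n])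
  with D' 1 P show ?case by (intro bexI[of _ ?P]) simp_all
qed

section \<open>The second largest eigenvalue\<close>

text \<open>The diagonalization restated as coordinates in an orthonormal eigenbasis, ordered as in
  \<open>eigenvalues_desc\<close>, so that quadratic forms become weighted sums of squares.\<close>

lemma orthonormal_eigen_coordinates:
  fixes A :: "real mat"
  assumes A: "A \<in> carrier_mat n n" and sym: "transpose_mat A = A"
  obtains P where "P \<in> carrier_mat n n" "transpose_mat P * P = 1\<^sub>m n"
    "\<forall>x\<in>carrier_vec n. \<forall>y\<in>carrier_vec n. x \<bullet> y = (\<Sum>i<n. (transpose_mat P *\<^sub>v x) $ i * (transpose_mat P *\<^sub>v y) $ i)"
    "\<forall>x\<in>carrier_vec n. \<forall>i<n.
       (transpose_mat P *\<^sub>v (A *\<^sub>v x)) $ i = eigenvalues_desc A ! i * (transpose_mat P *\<^sub>v x) $ i"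
proof -
  let ?es = "eigenvalues_desc A"
  define D where "D = mat n n (\<lambda>(i, j). if i = j then ?es ! i else 0)"
  obtain P where P: "P \<in> carrier_mat n n" and PP: "transpose_mat P * P = 1\<^sub>m n"
    and D: "transpose_mat P * A * P = D"
    using symmetric_diagonalization[OF A sym char_poly_eigenvalues_desc(1)[OF A sym]]
    unfolding D_def by blast
  let ?Q = "transpose_mat P"
  have Q: "?Q \<in> carrier_mat n n" using P by simp
  have PP': "P * ?Q = 1\<^sub>m n" by (rule mat_mult_left_right_inverse[OF Q P PP])
  have sp: "x \<bullet> y = (\<Sum>i<n. (?Q *\<^sub>v x) $ i * (?Q *\<^sub>v y) $ i)"
    if x: "x \<in> carrier_vec n" and y: "y \<in> carrier_vec n" for x y
  proof -
    have Qy: "?Q *\<^sub>v y \<in> carrier_vec n" using Q y by simp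
    have "P *\<^sub>v (?Q *\<^sub>v y) = y"
      using PP' assoc_mult_mat_vec[OF P Q y] y by simp
    then have "x \<bullet> y = (?Q *\<^sub>v x) \<bullet> (?Q *\<^sub>v y)"
      using transpose_vec_mult_scalar[OF P Qy x] x P Qy
      by (metis Q comm_scalar_prod mult_mat_vec_carrier)
    also have "\<dots> = (\<Sum>i<n. (?Q *\<^sub>v x) $ i * (?Q *\<^sub>v y) $ i)"
      using P by (simp add: scalar_prod_def lessThan_atLeast0)
    finally show ?thesis .
  qed
  have ev: "(?Q *\<^sub>v (A *\<^sub>v x)) $ i = ?es ! i * (?Q *\<^sub>v x) $ i"
    if x: "x \<in> carrier_vec n" and i: "i < n" for x i
  proof -
    have Dc: "D \<in> carrier_mat n n" unfolding D_def by simp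
    have "?Q * A = D * ?Q"
    proof -
      have "D * ?Q = (?Q * A) * (P * ?Q)"
        unfolding D[symmetric] using A P Q
        by (simp add: assoc_mult_mat[where n\<^sub>1 = n and n\<^sub>2 = n and n\<^sub>3 = n and n\<^sub>4 = n])
      then show ?thesis using PP' A Q by simp
    qed
    then have "?Q *\<^sub>v (A *\<^sub>v x) = D *\<^sub>v (?Q *\<^sub>v x)"
      using assoc_mult_mat_vec[OF Q A x] assoc_mult_mat_vec[OF Dc Q x] by simp
    moreover have "(D *\<^sub>v y) $ i = ?es ! i * y $ i" if "y \<in> carrier_vec n" for y
    proof -
      have "(D *\<^sub>v y) $ i = (\<Sum>j<n. (if i = j then ?es ! i else 0) * y $ j)"
        using that i by (simp add: D_def scalar_prod_def lessThan_atLeast0)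
      also have "\<dots> = (\<Sum>j<n. if i = j then ?es ! i * y $ j else 0)"
        by (intro sum.cong) auto
      finally show ?thesis using i by simp
    qed
    ultimately show ?thesis using Q x by simp
  qed
  show thesis using that[OF P PP] sp ev by blast
qed

text \<open>Strictness on the complement of \<open>v\<close> leaves room for only one eigenvalue
  that is at least \<open>d\<close>. Hence \<open>v\<close> spans the first axis, a vector
  orthogonal to \<open>v\<close> has first coordinate zero, and all remaining weights are at most
  the second eigenvalue.\<close>

lemma second_eigenvalue_bound:
  fixes A :: "real mat"
  assumes A: "A \<in> carrier_mat n n" and sym: "transpose_mat A = A" and n: "n \<ge> 2"
    and v: "v \<in> carrier_vec n" "v \<noteq> 0\<^sub>v n" "A *\<^sub>v v = d \<cdot>\<^sub>v v"
    and strict: "\<And>x. x \<in> carrier_vec n \<Longrightarrow> x \<noteq> 0\<^sub>v n \<Longrightarrow> x \<bullet> v = 0 \<Longrightarrow>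
      x \<bullet> (A *\<^sub>v x) < d * (x \<bullet> x)"
  shows "eigenvalues_desc A ! 1 < d"
    and "\<And>x. x \<in> carrier_vec n \<Longrightarrow> x \<bullet> v = 0 \<Longrightarrow>
      x \<bullet> (A *\<^sub>v x) \<le> eigenvalues_desc A ! 1 * (x \<bullet> x)"
proof -
  let ?es = "eigenvalues_desc A"
  obtain P where P: "P \<in> carrier_mat n n" and QP: "transpose_mat P * P = 1\<^sub>m n"
    and sp: "\<forall>x\<in>carrier_vec n. \<forall>y\<in>carrier_vec n. x \<bullet> y = (\<Sum>i<n. (transpose_mat P *\<^sub>v x) $ i * (transpose_mat P *\<^sub>v y) $ i)"
    and ev: "\<forall>x\<in>carrier_vec n. \<forall>i<n.
       (transpose_mat P *\<^sub>v (A *\<^sub>v x)) $ i = ?es ! i * (transpose_mat P *\<^sub>v x) $ i"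
    using orthonormal_eigen_coordinates[OF A sym] .
  define c where "c x i = (transpose_mat P *\<^sub>v x) $ i" for x i
  note sp = sp[folded c_def, rule_format] and ev = ev[folded c_def, rule_format]
  have anti: "?es ! j \<le> ?es ! i" if "i \<le> j" "j < n" for i j
  proof -
    have "rev ?es ! (n - 1 - j) \<le> rev ?es ! (n - 1 - i)"
      using char_poly_eigenvalues_desc(2,3)[OF A sym] that by (intro sorted_nth_mono) auto
    then show ?thesis using char_poly_eigenvalues_desc(3)[OF A sym] that by (simp add: rev_nth)
  qed
  have Ax: "A *\<^sub>v x \<in> carrier_vec n" if "x \<in> carrier_vec n" for x using A that by simp
  show lt: "?es ! 1 < d"
  proof (rule ccontr)
    \<comment> \<open>Otherwise the span of the first two eigenvectors contains a nonzero vector orthogonal to \<open>v\<close>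
      on which the quadratic form is at least \<open>d\<close> times the squared norm.\<close>
    assume "\<not> ?es ! 1 < d"
    then have ge: "?es ! 1 \<ge> d" "?es ! 0 \<ge> d" using anti[of 0 1] n by auto
    \<comment> \<open>One linear condition on two coefficients has a nonzero solution; the condition
      will express orthogonality to \<open>v\<close>.\<close>
    obtain a b where ab: "a * c v 0 + b * c v 1 = 0" "a \<noteq> 0 \<or> b \<noteq> 0"
    proof (cases "c v 0 = 0")
      case True then show ?thesis by (intro that[of 1 0]) auto
    next
      case False then show ?thesis by (intro that[of "c v 1" "- c v 0"]) auto
    qed
    define y where "y = vec n (\<lambda>i. if i = 0 then a else if i = 1 then b else 0)"
    define x where "x = P *\<^sub>v y"
    have y: "y \<in> carrier_vec n" unfolding y_def by simp
    have x: "x \<in> carrier_vec n" unfolding x_def using P y by simp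
    have "transpose_mat P *\<^sub>v x = y"
      unfolding x_def using assoc_mult_mat_vec[of "transpose_mat P" n n P n y] P y QP by simp
    then have cx: "c x i = (if i = 0 then a else if i = 1 then b else 0)" if "i < n" for i
      unfolding c_def y_def using that by simp
    have two: "(\<Sum>i<n. c x i * f i) = a * f 0 + b * f 1" for f
    proof -
      have "(\<Sum>i<n. c x i * f i) = (\<Sum>i\<in>{0, 1}. c x i * f i)"
        using n by (intro sum.mono_neutral_right) (auto simp: cx)
      then show ?thesis using n by (simp add: cx)
    qed
    have cx01: "c x 0 = a" "c x 1 = b" using cx n by auto
    have xv: "x \<bullet> v = 0" using sp[OF x v(1)] two[of "c v"] ab(1) by simp
    have xx: "x \<bullet> x = a * a + b * b" using sp[OF x x] two[of "c x"] by (simp add: cx01 cx01[unfolded One_nat_def])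
    have xAx: "x \<bullet> (A *\<^sub>v x) = ?es ! 0 * (a * a) + ?es ! 1 * (b * b)"
      using sp[OF x Ax[OF x]] two[of "c (A *\<^sub>v x)"] ev[OF x, of 0] ev[OF x, of 1] n
      by (simp add: cx01 cx01[unfolded One_nat_def])
    have "x \<noteq> 0\<^sub>v n"
    proof
      assume "x = 0\<^sub>v n"
      then have "a * a + b * b = 0" using xx x by simp
      then show False using ab(2) by (simp add: sum_squares_eq_zero_iff)
    qed
    from strict[OF x this xv] have "?es ! 0 * (a * a) + ?es ! 1 * (b * b) < d * (a * a) + d * (b * b)"
      unfolding xx xAx by (simp add: distrib_left)
    moreover have "d * (a * a) \<le> ?es ! 0 * (a * a)" "d * (b * b) \<le> ?es ! 1 * (b * b)"
      using ge by (auto intro!: mult_right_mono)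
    ultimately show False by linarith
  qed
  \<comment> \<open>Comparing coordinates in the eigenvector equation of \<open>v\<close>: a nonzero
    coordinate here would make an eigenvalue below \<open>d\<close> equal to
    \<open>d\<close>.\<close>
  have cv: "c v i = 0" if "1 \<le> i" "i < n" for i
  proof -
    have "d * c v i = ?es ! i * c v i"
      using ev[OF v(1) that(2)] that(2) P v(1) unfolding v(3) c_def
      by (simp add: mult_mat_vec[where nr = n and nc = n])
    moreover have "?es ! i < d" using anti[OF that] lt by simp
    ultimately show ?thesis by simp
  qed
  have one: "(\<Sum>i<n. f i * c v i) = f 0 * c v 0" for f
  proof -
    have "(\<Sum>i<n. f i * c v i) = (\<Sum>i\<in>{0}. f i * c v i)"
      using n by (intro sum.mono_neutral_right) (auto simp: cv)
    then show ?thesis by simp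
  qed
  have "c v 0 \<noteq> 0"
  proof
    assume "c v 0 = 0"
    then have "v \<bullet> v = 0" using sp[OF v(1) v(1)] one[of "c v"] by simp
    then show False using v(1,2) conjugate_square_eq_0_vec[OF v(1)] by simp
  qed
  fix x :: "real vec" assume x: "x \<in> carrier_vec n" and xv: "x \<bullet> v = 0"
  have c0: "c x 0 = 0" using sp[OF x v(1)] one[of "c x"] xv \<open>c v 0 \<noteq> 0\<close> by simp
  have "x \<bullet> (A *\<^sub>v x) = (\<Sum>i<n. ?es ! i * (c x i)\<^sup>2)"
    unfolding sp[OF x Ax[OF x]] by (intro sum.cong) (auto simp: ev[OF x] power2_eq_square)
  also have "\<dots> \<le> (\<Sum>i<n. ?es ! 1 * (c x i)\<^sup>2)"
  proof (rule sum_mono)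
    fix i assume i: "i \<in> {..<n}"
    show "?es ! i * (c x i)\<^sup>2 \<le> ?es ! 1 * (c x i)\<^sup>2"
      using c0 anti[of 1 i] i by (cases "i = 0") (auto intro!: mult_right_mono)
  qed
  also have "\<dots> = ?es ! 1 * (x \<bullet> x)"
    unfolding sp[OF x x] by (simp add: sum_distrib_left power2_eq_square)
  finally show "x \<bullet> (A *\<^sub>v x) \<le> ?es ! 1 * (x \<bullet> x)" .
qed

section \<open>The adjacency form of a regular connected graph and its spectral gap\<close>

locale regular_connected_graph =
  fixes V :: "'v::linorder set" and E :: "'v set set" and \<Delta> :: nat
  assumes finite_V: "finite V" and card_V: "card V \<ge> 2" and \<Delta>_pos: "\<Delta> > 0"
    and edges: "e \<in> E \<Longrightarrow> \<exists>u\<in>V. \<exists>v\<in>V. u \<noteq> v \<and> e = {u, v}"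
    and regular: "regular_graph V E \<Delta>"
    and connected: "connected_graph V E"
begin

definition adj :: "'v \<Rightarrow> 'v \<Rightarrow> real" where "adj u v = of_bool ({u, v} \<in> E)"

lemma adj_commute: "adj u v = adj v u"
  by (simp add: adj_def insert_commute)

lemma edge_endpoints: "{u, v} \<in> E \<Longrightarrow> u \<in> V \<and> v \<in> V \<and> u \<noteq> v"
  using edges[of "{u, v}"] by (auto simp: doubleton_eq_iff)

text \<open>Sending a neighbour \<open>v\<close> to the edge \<open>{u, v}\<close> is a bijection
  onto the incident edges. It also gives each sub-block its length \<open>\<Delta>\<close>.\<close>

lemma card_neighbours:
  assumes "u \<in> V"
  shows "card {v. {u, v} \<in> E} = \<Delta>"
proof -
  have "incident_edges E u = (\<lambda>v. {u, v}) ` {v. {u, v} \<in> E}"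
    using edges by (fastforce simp: incident_edges_def insert_commute)
  moreover have "inj_on (\<lambda>v. {u, v}) {v. {u, v} \<in> E}"
    by (auto simp: inj_on_def doubleton_eq_iff)
  ultimately show ?thesis
    using regular assms unfolding regular_graph_def by (metis card_image)
qed

lemma sum_adj: "u \<in> V \<Longrightarrow> (\<Sum>v\<in>V. adj u v) = \<Delta>"
proof -
  assume u: "u \<in> V"
  have "(\<Sum>v\<in>V. adj u v) = real (card (V \<inter> {v. {u, v} \<in> E}))"
    unfolding adj_def using finite_V by (simp add: sum_of_bool_eq Int_def)
  also have "V \<inter> {v. {u, v} \<in> E} = {v. {u, v} \<in> E}" using edge_endpoints by auto
  finally show ?thesis using card_neighbours[OF u] by simp
qed

text \<open>The quadratic form of the adjacency matrix; the sum runs over ordered pairs, so each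
  edge counts twice.\<close>

definition quad :: "('v \<Rightarrow> real) \<Rightarrow> real" where
  "quad f = (\<Sum>u\<in>V. \<Sum>v\<in>V. adj u v * f u * f v)"

text \<open>Expand the square: by regularity and symmetry of \<open>adj\<close>, each of the two
  pure squares contributes \<open>\<Delta>\<close> times the squared norm.\<close>

lemma laplacian:
  fixes f :: "'v \<Rightarrow> real"
  shows
  "(\<Sum>u\<in>V. \<Sum>v\<in>V. adj u v * (f u - f v)\<^sup>2) = 2 * (\<Delta> * (\<Sum>u\<in>V. (f u)\<^sup>2) - quad f)"
proof -
  have 1: "(\<Sum>u\<in>V. \<Sum>v\<in>V. adj u v * (f u)\<^sup>2) = \<Delta> * (\<Sum>u\<in>V. (f u)\<^sup>2)"
    by (simp add: sum_distrib_right[symmetric] sum_adj sum_distrib_left)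
  then have 2: "(\<Sum>u\<in>V. \<Sum>v\<in>V. adj u v * (f v)\<^sup>2) = \<Delta> * (\<Sum>u\<in>V. (f u)\<^sup>2)"
    by (subst sum.swap) (simp add: adj_commute)
  have "(\<Sum>u\<in>V. \<Sum>v\<in>V. adj u v * (f u - f v)\<^sup>2) =
      (\<Sum>u\<in>V. \<Sum>v\<in>V. adj u v * (f u)\<^sup>2 + adj u v * (f v)\<^sup>2 - 2 * (adj u v * f u * f v))"
    by (intro sum.cong refl) (simp add: power2_diff algebra_simps)
  also have "\<dots> = 2 * (\<Delta> * (\<Sum>u\<in>V. (f u)\<^sup>2) - quad f)"
    unfolding quad_def by (simp add: sum.distrib sum_subtractf 1 2 flip: sum_distrib_left)
  finally show ?thesis .
qed

text \<open>Otherwise the nonnegative Laplacian sum vanishes, so \<open>f\<close> is constant along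
  edges and by connectedness on \<open>V\<close>; a nonzero constant does not sum to zero.\<close>

lemma quad_strict:
  fixes f :: "'v \<Rightarrow> real"
  assumes sum0: "(\<Sum>v\<in>V. f v) = 0" and nz: "w \<in> V" "f w \<noteq> 0"
  shows "quad f < \<Delta> * (\<Sum>u\<in>V. (f u)\<^sup>2)"
proof (rule ccontr)
  assume "\<not> ?thesis"
  then have le: "(\<Sum>u\<in>V. \<Sum>v\<in>V. adj u v * (f u - f v)\<^sup>2) \<le> 0" unfolding laplacian by simp
  have nonneg: "adj u v * (f u - f v)\<^sup>2 \<ge> 0" for u v by (simp add: adj_def)
  have step: "f u = f v" if "{u, v} \<in> E" for u v
  proof -
    have uv: "u \<in> V" "v \<in> V" using edge_endpoints[OF that] by auto
    have "(\<Sum>v\<in>V. adj u v * (f u - f v)\<^sup>2) \<le> (\<Sum>u\<in>V. \<Sum>v\<in>V. adj u v * (f u - f v)\<^sup>2)"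
      using uv finite_V nonneg by (intro member_le_sum[where f = "\<lambda>u. \<Sum>v\<in>V. adj u v * (f u - f v)\<^sup>2"]) (auto intro!: sum_nonneg)
    moreover have "adj u v * (f u - f v)\<^sup>2 \<le> (\<Sum>v\<in>V. adj u v * (f u - f v)\<^sup>2)"
      using uv finite_V nonneg by (intro member_le_sum[where f = "\<lambda>v. adj u v * (f u - f v)\<^sup>2"]) auto
    ultimately have "adj u v * (f u - f v)\<^sup>2 = 0" using le nonneg[of u v] by linarith
    then show ?thesis using that by (simp add: adj_def)
  qed
  have "f u = f w" if "u \<in> V" for u
  proof -
    have "(u, w) \<in> {(x, y). {x, y} \<in> E}\<^sup>*"
      using connected that nz(1) unfolding connected_graph_def by blast
    then show ?thesis by (induction rule: rtrancl_induct) (use step in auto)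
  qed
  then have "(\<Sum>v\<in>V. f v) = card V * f w" by simp
  then show False using sum0 nz card_V by simp
qed

text \<open>Uses the same enumeration of \<open>V\<close> as \<open>adjacency_mat\<close>, so that
  matrix statements translate into sums over vertices.\<close>

definition graph_vec :: "('v \<Rightarrow> real) \<Rightarrow> real vec" where
  "graph_vec f = vec (card V) (\<lambda>i. f (sorted_list_of_set V ! i))"

lemma graph_vec_carrier [simp]: "graph_vec f \<in> carrier_vec (card V)"
  by (simp add: graph_vec_def)

lemma bij_betw_nth_V: "bij_betw ((!) (sorted_list_of_set V)) {..<card V} V"
  using finite_V by (intro bij_betw_nth) auto

lemma graph_vec_scalar_prod: "graph_vec f \<bullet> graph_vec g = (\<Sum>v\<in>V. f v * g v)"
  using sum.reindex_bij_betw[OF bij_betw_nth_V, of "\<lambda>v. f v * g v"]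
  by (simp add: graph_vec_def scalar_prod_def lessThan_atLeast0)

lemma adjacency_mat_carrier: "adjacency_mat V E \<in> carrier_mat (card V) (card V)"
  by (simp add: adjacency_mat_def)

lemma adjacency_mat_symmetric: "transpose_mat (adjacency_mat V E) = adjacency_mat V E"
  by (rule eq_matI) (auto simp: adjacency_mat_def insert_commute)

lemma adjacency_mat_graph_vec:
  "adjacency_mat V E *\<^sub>v graph_vec f = graph_vec (\<lambda>u. \<Sum>v\<in>V. adj u v * f v)"
proof (rule eq_vecI)
  let ?xs = "sorted_list_of_set V"
  fix i assume "i < dim_vec (graph_vec (\<lambda>u. \<Sum>v\<in>V. adj u v * f v))"
  then have i: "i < card V" by (simp add: graph_vec_def)
  have "(adjacency_mat V E *\<^sub>v graph_vec f) $ i = (\<Sum>j<card V. adj (?xs ! i) (?xs ! j) * f (?xs ! j))"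
    using i by (simp add: adjacency_mat_def graph_vec_def scalar_prod_def lessThan_atLeast0 adj_def of_bool_def)
  also have "\<dots> = (\<Sum>v\<in>V. adj (?xs ! i) v * f v)"
    by (rule sum.reindex_bij_betw[OF bij_betw_nth_V, of "\<lambda>v. adj (?xs ! i) v * f v"])
  finally show "(adjacency_mat V E *\<^sub>v graph_vec f) $ i = graph_vec (\<lambda>u. \<Sum>v\<in>V. adj u v * f v) $ i"
    using i by (simp add: graph_vec_def)
qed (simp add: graph_vec_def adjacency_mat_def)

lemma graph_vec_quad: "graph_vec f \<bullet> (adjacency_mat V E *\<^sub>v graph_vec f) = quad f"
  unfolding adjacency_mat_graph_vec graph_vec_scalar_prod quad_def
  by (simp add: sum_distrib_left mult_ac)

lemma graph_vec_surj:
  assumes "x \<in> carrier_vec (card V)"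
  obtains f where "x = graph_vec f"
proof
  let ?xs = "sorted_list_of_set V"
  show "x = graph_vec (\<lambda>v. x $ the_inv_into {..<card V} ((!) ?xs) v)"
    using assms the_inv_into_f_f[OF bij_betw_imp_inj_on[OF bij_betw_nth_V]]
    by (intro eq_vecI) (auto simp: graph_vec_def)
qed

text \<open>Instance of \<open>second_eigenvalue_bound\<close> at the all-ones vector, an
  eigenvector for \<open>\<Delta>\<close> by regularity; \<open>quad_strict\<close> supplies the
  strict inequality.\<close>

lemma second_eigenvalue_graph:
  shows graph_gamma_less_1: "graph_gamma V E \<Delta> < 1"
    and quad_le: "(\<Sum>v\<in>V. f v) = 0 \<Longrightarrow> quad f \<le> graph_gamma V E \<Delta> * \<Delta> * (\<Sum>u\<in>V. (f u)\<^sup>2)"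
proof -
  let ?A = "adjacency_mat V E" and ?v = "graph_vec (\<lambda>_. 1)"
  have v0: "?v \<noteq> 0\<^sub>v (card V)"
  proof
    assume "?v = 0\<^sub>v (card V)"
    then have "?v $ 0 = 0" using card_V by simp
    then show False using card_V by (simp add: graph_vec_def)
  qed
  have Av: "?A *\<^sub>v ?v = real \<Delta> \<cdot>\<^sub>v ?v"
  proof -
    have "sorted_list_of_set V ! i \<in> V" if "i < card V" for i
      using bij_betwE[OF bij_betw_nth_V] that by auto
    then show ?thesis unfolding adjacency_mat_graph_vec
      by (intro eq_vecI) (auto simp: graph_vec_def sum_adj)
  qed
  have strict: "x \<bullet> (?A *\<^sub>v x) < real \<Delta> * (x \<bullet> x)"
    if "x \<in> carrier_vec (card V)" "x \<noteq> 0\<^sub>v (card V)" "x \<bullet> ?v = 0" for x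
  proof -
    note x = that
    obtain f where f: "x = graph_vec f" using graph_vec_surj[OF x(1)] .
    obtain w where "w \<in> V" "f w \<noteq> 0"
    proof -
      obtain i where "i < card V" "x $ i \<noteq> 0" using x by (metis carrier_vecD eq_vecI index_zero_vec)
      then show thesis using that[of "sorted_list_of_set V ! i"] bij_betwE[OF bij_betw_nth_V]
        by (auto simp: f graph_vec_def)
    qed
    moreover have "(\<Sum>v\<in>V. f v) = 0" using x(3) by (simp add: f graph_vec_scalar_prod)
    ultimately show ?thesis
      using quad_strict[of f w] unfolding f graph_vec_quad graph_vec_scalar_prod
      by (simp add: power2_eq_square)
  qed
  note bound = second_eigenvalue_bound[where A = ?A and v = ?v and d = "real \<Delta>",
      OF adjacency_mat_carrier adjacency_mat_symmetric card_V graph_vec_carrier v0 Av]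
  have less: "eigenvalues_desc ?A ! 1 < real \<Delta>" by (rule bound(1)) (rule strict)
  show "graph_gamma V E \<Delta> < 1" using less \<Delta>_pos by (simp add: graph_gamma_def)
  assume "(\<Sum>v\<in>V. f v) = 0"
  then have "graph_vec f \<bullet> ?v = 0" by (simp add: graph_vec_scalar_prod)
  then have "graph_vec f \<bullet> (?A *\<^sub>v graph_vec f) \<le>
      eigenvalues_desc ?A ! 1 * (graph_vec f \<bullet> graph_vec f)"
    by (intro bound(2) strict graph_vec_carrier)
  then show "quad f \<le> graph_gamma V E \<Delta> * \<Delta> * (\<Sum>u\<in>V. (f u)\<^sup>2)"
    using \<Delta>_pos by (simp add: graph_vec_quad graph_vec_scalar_prod graph_gamma_def power2_eq_square)
qed

end

section \<open>Mixing in bipartite graphs\<close>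

locale bipartite_regular_graph =
  fixes V' V'' :: "'v::linorder set" and E :: "'v set set" and \<Delta> n :: nat
  assumes bipartite: "bipartite_graph V' V'' E"
    and regular': "regular_graph (V' \<union> V'') E \<Delta>"
    and connected': "connected_graph (V' \<union> V'') E"
    and card_V': "card V' = n" and card_V'': "card V'' = n" and n_gt_1: "n > 1"
    and degree_pos: "\<Delta> > 0"
begin

lemma finite_parts: "finite V'" "finite V''" and disjoint_parts: "V' \<inter> V'' = {}"
  using bipartite by (auto simp: bipartite_graph_def)

sublocale regular_connected_graph "V' \<union> V''" E \<Delta>
proof
  show "card (V' \<union> V'') \<ge> 2"
    using card_Un_disjoint[OF finite_parts disjoint_parts] card_V' n_gt_1 by simp
  show "\<exists>u\<in>V' \<union> V''. \<exists>v\<in>V' \<union> V''. u \<noteq> v \<and> e = {u, v}" if e: "e \<in> E" for e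
  proof -
    obtain u v where "u \<in> V'" "v \<in> V''" "e = {u, v}"
      using bipartite e unfolding bipartite_graph_def by meson
    then show ?thesis using disjoint_parts by (intro bexI[of _ u] bexI[of _ v]) auto
  qed
qed (use finite_parts degree_pos regular' connected' in auto)

abbreviation \<gamma> :: real where "\<gamma> \<equiv> graph_gamma (V' \<union> V'') E \<Delta>"

lemma edge_parts: "{u, v} \<in> E \<Longrightarrow> u \<in> V' \<and> v \<in> V'' \<or> u \<in> V'' \<and> v \<in> V'"
proof -
  assume "{u, v} \<in> E"
  then obtain x y where "x \<in> V'" "y \<in> V''" "{u, v} = {x, y}"
    using bipartite unfolding bipartite_graph_def by meson
  then show ?thesis by (auto simp: doubleton_eq_iff)
qed

lemma adj_same_part:
  "u \<in> V' \<Longrightarrow> v \<in> V' \<Longrightarrow> adj u v = 0" "u \<in> V'' \<Longrightarrow> v \<in> V'' \<Longrightarrow> adj u v = 0"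
  using edge_parts[of u v] disjoint_parts by (auto simp: adj_def)

lemma sum_adj_parts:
  "u \<in> V' \<Longrightarrow> (\<Sum>v\<in>V''. adj u v) = \<Delta>" "v \<in> V'' \<Longrightarrow> (\<Sum>u\<in>V'. adj u v) = \<Delta>"
  using sum_adj[of u] sum_adj[of v] adj_commute[of _ v]
  by (simp_all add: sum.union_disjoint[OF finite_parts disjoint_parts] adj_same_part)

text \<open>The bilinear form of the off-diagonal block of the adjacency matrix. At the indicators
  of \<open>S\<close> and \<open>T\<close> it counts the edges between them.\<close>

definition cross_form :: "('v \<Rightarrow> real) \<Rightarrow> ('v \<Rightarrow> real) \<Rightarrow> real" where
  "cross_form a b = (\<Sum>u\<in>V'. \<Sum>v\<in>V''. adj u v * a u * b v)"

text \<open>Glue \<open>a\<close> and \<open>b\<close> to one function of sum zero on all vertices.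
  Since no edge stays inside a part, its quadratic form is twice the cross form, and
  \<open>quad_le\<close> applies.\<close>

lemma cross_form_le:
  assumes "(\<Sum>u\<in>V'. a u) = 0" "(\<Sum>v\<in>V''. b v) = 0"
  shows "2 * cross_form a b \<le> \<gamma> * \<Delta> * ((\<Sum>u\<in>V'. (a u)\<^sup>2) + (\<Sum>v\<in>V''. (b v)\<^sup>2))"
proof -
  define f where "f w = (if w \<in> V' then a w else b w)" for w
  have f: "\<And>u. u \<in> V' \<Longrightarrow> f u = a u" "\<And>v. v \<in> V'' \<Longrightarrow> f v = b v"
    using disjoint_parts by (auto simp: f_def)
  note un = sum.union_disjoint[OF finite_parts disjoint_parts]
  have "(\<Sum>u\<in>V''. \<Sum>v\<in>V'. adj u v * b u * a v) = cross_form a b"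
    unfolding cross_form_def by (subst sum.swap) (simp add: adj_commute mult_ac)
  then have "quad f = 2 * cross_form a b"
    unfolding quad_def un by (simp add: sum.distrib f adj_same_part cross_form_def)
  moreover have "(\<Sum>w\<in>V' \<union> V''. f w) = 0" using assms by (simp add: un f)
  moreover have "(\<Sum>w\<in>V' \<union> V''. (f w)\<^sup>2) = (\<Sum>u\<in>V'. (a u)\<^sup>2) + (\<Sum>v\<in>V''. (b v)\<^sup>2)"
    by (simp add: un f)
  ultimately show ?thesis using quad_le[of f] by simp
qed

text \<open>Test \<open>cross_form_le\<close> with the difference of two point masses in
  \<open>V'\<close> and zero on \<open>V''\<close>: the left side vanishes while the squared norm is
  positive.\<close>

lemma graph_gamma_nonneg: "\<gamma> \<ge> 0"
proof -
  obtain x y where xy: "x \<in> V'" "y \<in> V'" "x \<noteq> y"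
    using card_le_Suc0_iff_eq[OF finite_parts(1)] card_V' n_gt_1 by force
  define a :: "'v \<Rightarrow> real" where "a u = of_bool (u = x) - of_bool (u = y)" for u
  have "(\<Sum>u\<in>V'. a u) = 0"
    using xy finite_parts by (simp add: a_def sum_subtractf of_bool_def sum.delta')
  from cross_form_le[OF this, of "\<lambda>_. 0"]
  have "0 \<le> \<gamma> * (\<Delta> * (\<Sum>u\<in>V'. (a u)\<^sup>2))" by (simp add: cross_form_def mult.assoc)
  moreover have "\<Delta> * (\<Sum>u\<in>V'. (a u)\<^sup>2) > 0"
    using xy finite_parts degree_pos
    by (intro mult_pos_pos sum_pos2[of _ x]) (auto simp: a_def)
  ultimately show ?thesis by (simp add: zero_le_mult_iff)
qed

text \<open>Expand the product; all rows and columns of the off-diagonal block sum to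
  \<open>\<Delta>\<close>, which evaluates the terms other than \<open>cross_form a b\<close>. It
  serves to centre and weight indicators.\<close>

lemma cross_form_affine:
  "cross_form (\<lambda>u. q * (a u - s)) (\<lambda>v. p * (b v - t)) =
     p * q * (cross_form a b - s * \<Delta> * (\<Sum>v\<in>V''. b v) - t * \<Delta> * (\<Sum>u\<in>V'. a u) + s * t * n * \<Delta>)"
proof -
  have 1: "(\<Sum>u\<in>V'. \<Sum>v\<in>V''. adj u v * b v) = \<Delta> * (\<Sum>v\<in>V''. b v)"
    by (subst sum.swap) (simp add: sum_adj_parts sum_distrib_left flip: sum_distrib_right)
  have 2: "(\<Sum>u\<in>V'. \<Sum>v\<in>V''. adj u v * a u) = \<Delta> * (\<Sum>u\<in>V'. a u)"
    by (simp add: sum_adj_parts sum_distrib_left flip: sum_distrib_right)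
  have 3: "(\<Sum>u\<in>V'. \<Sum>v\<in>V''. adj u v) = n * \<Delta>" by (simp add: sum_adj_parts card_V')
  have "cross_form (\<lambda>u. q * (a u - s)) (\<lambda>v. p * (b v - t)) =
      (\<Sum>u\<in>V'. \<Sum>v\<in>V''. p * q * (adj u v * a u * b v - s * (adj u v * b v)
         - t * (adj u v * a u) + s * t * adj u v))"
    unfolding cross_form_def by (intro sum.cong refl) (simp add: algebra_simps)
  also have "\<dots> = p * q * (cross_form a b - s * (\<Delta> * (\<Sum>v\<in>V''. b v))
      - t * (\<Delta> * (\<Sum>u\<in>V'. a u)) + s * t * (n * \<Delta>))"
    unfolding cross_form_def 1[symmetric] 2[symmetric] 3[symmetric]
    by (simp add: sum.distrib sum_subtractf flip: sum_distrib_left)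
  finally show ?thesis by (simp add: mult.assoc)
qed

text \<open>The expander mixing lemma, from \<open>cross_form_le\<close> at centred indicators. The
  negative term \<open>- \<gamma> * (\<sigma> * \<tau>)\<close> is kept because it yields the
  denominator \<open>1 - \<gamma>\<close> of the final bound.\<close>

lemma mixing:
  assumes S: "S \<subseteq> V'" "S \<noteq> {}" and T: "T \<subseteq> V''" "T \<noteq> {}"
  defines "\<sigma> \<equiv> card S / n" and "\<tau> \<equiv> card T / n"
  shows "(\<Sum>u\<in>S. \<Sum>v\<in>T. adj u v) \<le> \<Delta> * n * ((1 - \<gamma>) * (\<sigma> * \<tau>) + \<gamma> * sqrt (\<sigma> * \<tau>))"
proof -
  define p where "p = sqrt \<sigma>"
  define q where "q = sqrt \<tau>"
  have fin: "finite S" "finite T" using S T finite_parts finite_subset by auto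
  have n0: "real n > 0" using n_gt_1 by simp
  have pq: "p > 0" "q > 0"
    using S T fin n0 by (auto simp: p_def q_def \<sigma>_def \<tau>_def card_gt_0_iff)
  have p2: "p\<^sup>2 = \<sigma>" and q2: "q\<^sup>2 = \<tau>" by (auto simp: p_def q_def \<sigma>_def \<tau>_def)
  have S1: "(\<Sum>u\<in>V'. of_bool (u \<in> S) :: real) = n * \<sigma>"
    using S finite_parts n0 by (simp add: sum_of_bool_eq \<sigma>_def inf.absorb2 Int_def[symmetric])
  have T1: "(\<Sum>v\<in>V''. of_bool (v \<in> T) :: real) = n * \<tau>"
    using T finite_parts n0 by (simp add: sum_of_bool_eq \<tau>_def inf.absorb2 Int_def[symmetric])
  let ?e = "\<Sum>u\<in>S. \<Sum>v\<in>T. adj u v"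
  have e: "cross_form (\<lambda>u. of_bool (u \<in> S)) (\<lambda>v. of_bool (v \<in> T)) = ?e"
  proof -
    have "cross_form (\<lambda>u. of_bool (u \<in> S)) (\<lambda>v. of_bool (v \<in> T)) =
        (\<Sum>u\<in>S. \<Sum>v\<in>V''. adj u v * of_bool (v \<in> T))"
      unfolding cross_form_def using S finite_parts by (intro sum.mono_neutral_cong_right) auto
    also have "\<dots> = ?e"
      using T finite_parts by (intro sum.cong refl sum.mono_neutral_cong_right) auto
    finally show ?thesis .
  qed
  \<comment> \<open>With the weights \<open>q\<close> and \<open>p\<close>, the sum of squares in \<open>cross_form_le\<close> becomes
    \<open>n(pq)\<^sup>2(2 - p\<^sup>2 - q\<^sup>2)\<close>, which is at most \<open>2n(pq)\<^sup>2(1 - pq)\<close>.\<close>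
  define a where "a u = q * (of_bool (u \<in> S) - \<sigma>)" for u
  define b where "b v = p * (of_bool (v \<in> T) - \<tau>)" for v
  have a0: "(\<Sum>u\<in>V'. a u) = 0"
    using S1 by (simp add: a_def sum_subtractf card_V' flip: sum_distrib_left)
  have b0: "(\<Sum>v\<in>V''. b v) = 0"
    using T1 by (simp add: b_def sum_subtractf card_V'' flip: sum_distrib_left)
  \<comment> \<open>The sum is \<open>r\<^sup>2 * n\<close> times the variance of an indicator of
    mean \<open>x\<close>.\<close>
  have var: "(\<Sum>w\<in>W. (r * (of_bool (w \<in> U) - x))\<^sup>2) = r\<^sup>2 * (n * (x * (1 - x)))"
    if "(\<Sum>w\<in>W. of_bool (w \<in> U) :: real) = n * x" "card W = n" for W U :: "'v set" and r x :: real
  proof -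
    have "(r * (of_bool (w \<in> U) - x))\<^sup>2 = r\<^sup>2 * ((1 - 2 * x) * of_bool (w \<in> U) + x\<^sup>2)" for w
      by (auto simp: power2_eq_square algebra_simps)
    then have "(\<Sum>w\<in>W. (r * (of_bool (w \<in> U) - x))\<^sup>2) = r\<^sup>2 * ((1 - 2 * x) * (n * x) + n * x\<^sup>2)"
      using that by (simp add: sum.distrib flip: sum_distrib_left)
    then show ?thesis by (simp add: power2_eq_square algebra_simps)
  qed
  \<comment> \<open>At the means, the three corrections in \<open>cross_form_affine\<close> have
    equal size, two negative and one positive, so a single subtraction remains.\<close>
  have "2 * (p * q) * (?e - \<sigma> * \<tau> * n * \<Delta>) = 2 * cross_form a b"
    unfolding a_def[abs_def] b_def[abs_def] cross_form_affine e S1 T1 by (simp add: algebra_simps)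
  also have "\<dots> \<le> \<gamma> * \<Delta> * (q\<^sup>2 * (n * (\<sigma> * (1 - \<sigma>))) + p\<^sup>2 * (n * (\<tau> * (1 - \<tau>))))"
    using cross_form_le[OF a0 b0] var[OF S1 card_V', of q] var[OF T1 card_V'', of p]
    unfolding a_def b_def by simp
  also have "\<dots> = \<gamma> * \<Delta> * n * (p * q)\<^sup>2 * (2 - (p\<^sup>2 + q\<^sup>2))"
    unfolding p2[symmetric] q2[symmetric] by (simp add: algebra_simps power2_eq_square)
  also have "\<dots> \<le> \<gamma> * \<Delta> * n * (p * q)\<^sup>2 * (2 - 2 * (p * q))"
    using graph_gamma_nonneg sum_squares_bound[of p q] by (intro mult_left_mono) auto
  also have "\<dots> = 2 * (p * q) * (\<gamma> * \<Delta> * n * (p * q) * (1 - p * q))"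
    by (simp add: power2_eq_square algebra_simps)
  \<comment> \<open>Division by \<open>2 * (p * q)\<close>, which is positive because
    \<open>S\<close> and \<open>T\<close> are nonempty.\<close>
  finally have "?e - \<sigma> * \<tau> * n * \<Delta> \<le> \<gamma> * \<Delta> * n * (p * q) * (1 - p * q)"
    using pq by simp
  moreover have s: "sqrt (\<sigma> * \<tau>) = p * q" by (simp add: p_def q_def real_sqrt_mult)
  moreover have pqpq: "\<sigma> * \<tau> = (p * q) * (p * q)"
    using p2 q2 by (simp add: power2_eq_square mult_ac)
  ultimately show ?thesis unfolding s unfolding pqpq by (simp add: algebra_simps)
qed

end

text \<open>In terms of square roots, each hypothesis loses one factor \<open>q\<close> or
  \<open>p\<close> by cancellation, and the case split bounds the leftover ratio of \<open>p\<close>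
  and \<open>q\<close> by \<open>k\<close>.\<close>

lemma expander_distance_arith:
  fixes \<sigma> \<tau> \<theta> \<delta> g :: real
  assumes pos: "\<sigma> > 0" "\<tau> > 0" "\<theta> > 0" "\<delta> > 0" and g: "0 \<le> g" "g < 1"
    and le\<theta>: "\<theta> * \<sigma> \<le> (1 - g) * (\<sigma> * \<tau>) + g * sqrt (\<sigma> * \<tau>)"
    and le\<delta>: "\<delta> * \<tau> \<le> (1 - g) * (\<sigma> * \<tau>) + g * sqrt (\<sigma> * \<tau>)"
  shows "(\<delta> - g * sqrt (\<delta> / \<theta>)) / (1 - g) \<le> \<sigma>"
proof -
  define p where "p = sqrt \<sigma>"
  define q where "q = sqrt \<tau>"
  define k where "k = sqrt (\<delta> / \<theta>)"
  have p: "p > 0" "\<sigma> = p\<^sup>2" and q: "q > 0" "\<tau> = q\<^sup>2" using pos by (auto simp: p_def q_def)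
  have k: "k > 0" "\<delta> = k\<^sup>2 * \<theta>" using pos by (auto simp: k_def)
  have s: "sqrt (\<sigma> * \<tau>) = p * q" by (simp add: p_def q_def real_sqrt_mult)
  have "\<delta> \<le> (1 - g) * p\<^sup>2 + g * k"
  \<comment> \<open>This is the condition \<open>\<theta> * \<sigma> \<le> \<delta> * \<tau>\<close>
    after taking square roots.\<close>
  proof (cases "p \<le> k * q")
    case True
    have "q * (q * \<delta>) \<le> q * (q * ((1 - g) * p\<^sup>2) + g * p)"
      using le\<delta> unfolding s unfolding p(2) q(2) by (simp add: algebra_simps power2_eq_square)
    then have "q * \<delta> \<le> q * ((1 - g) * p\<^sup>2) + g * p" using q by (simp only: mult_le_cancel_left_pos)
    also have "\<dots> \<le> q * ((1 - g) * p\<^sup>2) + g * (k * q)" using True g by (simp add: mult_left_mono)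
    also have "\<dots> = q * ((1 - g) * p\<^sup>2 + g * k)" by (simp add: algebra_simps)
    finally show ?thesis using q by (simp only: mult_le_cancel_left_pos)
  next
    case False
    then have kq: "k * q \<le> p" by simp
    have "p * (p * \<theta>) \<le> p * (p * ((1 - g) * q\<^sup>2) + g * q)"
      using le\<theta> unfolding s unfolding p(2) q(2) by (simp add: algebra_simps power2_eq_square)
    then have "p * \<theta> \<le> p * ((1 - g) * q\<^sup>2) + g * q" using p by (simp only: mult_le_cancel_left_pos)
    \<comment> \<open>The factor \<open>k\<^sup>2\<close> turns \<open>\<theta>\<close> into
      \<open>\<delta>\<close> and makes \<open>k * q\<close> appear, which may then be replaced by
      the larger \<open>p\<close>.\<close>
    then have "k\<^sup>2 * (p * \<theta>) \<le> k\<^sup>2 * (p * ((1 - g) * q\<^sup>2) + g * q)" by (rule mult_left_mono) simp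
    also have "\<dots> = p * ((1 - g) * (k * q)\<^sup>2) + g * k * (k * q)"
      by (simp add: algebra_simps power2_eq_square)
    also have "\<dots> \<le> p * ((1 - g) * p\<^sup>2) + g * k * p"
      using kq k q p g by (intro add_mono mult_left_mono power_mono) auto
    finally have "p * \<delta> \<le> p * ((1 - g) * p\<^sup>2 + g * k)" unfolding k(2) by (simp add: algebra_simps)
    then show ?thesis using p by (simp only: mult_le_cancel_left_pos)
  qed
  then show ?thesis using g unfolding k_def[symmetric] p(2) by (simp add: pos_divide_le_eq mult.commute)
qed

section \<open>Linear codes and their encoders\<close>

text \<open>An injective map sends a basis to an independent set; by equality of dimensions that set
  is a basis of the target, so the image is everything.\<close>

lemma (in linear_map) inj_dim_eq_imp_surj:
  assumes fV: "V.fin_dim" and fW: "W.fin_dim" and inj: "inj_on T (carrier V)"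
    and dim: "vectorspace.dim K W = vectorspace.dim K V"
  shows "T ` carrier V = carrier W"
proof
  show "T ` carrier V \<subseteq> carrier W" using T_im by auto
  obtain B where B: "finite B" "V.basis B" using V.finite_basis_exists[OF fV] by blast
  have BV: "B \<subseteq> carrier V" and Bli: "V.module.lin_indpt B" using B(2) unfolding V.basis_def by auto
  have TB: "T ` B \<subseteq> carrier W" using BV T_im by auto
  have injB: "inj_on T B" using inj BV inj_on_subset by blast
  have "W.module.lin_indpt (T ` B)"
  proof (rule W.module.finite_lin_indpt2[OF finite_imageI[OF B(1)] TB], intro ballI)
    fix a v assume a: "a \<in> T ` B \<rightarrow> carrier K" and 0: "W.module.lincomb a (T ` B) = \<zero>\<^bsub>W\<^esub>"
      and v: "v \<in> T ` B"
    have aT: "a \<circ> T \<in> B \<rightarrow> carrier K" using a by auto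
    have c: "V.module.lincomb (a \<circ> T) B \<in> carrier V" using BV aT by (intro V.module.lincomb_closed) auto
    have "T (V.module.lincomb (a \<circ> T) B) = \<zero>\<^bsub>W\<^esub>"
      using lincomb_linear_image[OF inj BV a B(1)] 0 by simp
    then have "V.module.lincomb (a \<circ> T) B = \<zero>\<^bsub>V\<^esub>"
      using inj c by (metis T_ker V.module.M.zero_closed inj_onD f0_is_0)
    then have "a \<circ> T \<in> B \<rightarrow> {\<zero>\<^bsub>K\<^esub>}"
      by (intro V.not_lindepD[OF Bli B(1) subset_refl aT])
    then show "a v = \<zero>\<^bsub>K\<^esub>" using v by auto
  qed
  moreover have "card (T ` B) = W.dim"
    using V.dim_basis[OF B] card_image[OF injB] dim by simp
  ultimately have "W.basis (T ` B)"
    using W.dim_li_is_basis[OF fW finite_imageI[OF B(1)] TB] by simp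
  then have gen: "W.module.gen_set (T ` B)" unfolding W.basis_def by simp
  show "carrier W \<subseteq> T ` carrier V"
  proof
    fix w assume "w \<in> carrier W"
    then have "w \<in> W.module.span (T ` B)" using gen by simp
    then obtain a where a: "a \<in> T ` B \<rightarrow> carrier K" "w = W.module.lincomb a (T ` B)"
      using W.module.finite_in_span[OF finite_imageI[OF B(1)] TB] by blast
    have "V.module.lincomb (a \<circ> T) B \<in> carrier V" using BV a(1) by (intro V.module.lincomb_closed) auto
    then show "w \<in> T ` carrier V" unfolding a(2) lincomb_linear_image[OF inj BV a(1) B(1)] by simp
  qed
qed

lemma finite_carrier_vec: "finite (carrier_vec n :: 'a::finite vec set)"
proof -
  have "carrier_vec n \<subseteq> vec_of_list ` {xs :: 'a list. set xs \<subseteq> UNIV \<and> length xs = n}"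
    by (auto simp: image_iff intro!: exI[of _ "list_of_vec _"] vec_list[symmetric])
  then show ?thesis by (rule finite_subset) (intro finite_imageI finite_lists_length_eq, simp)
qed

text \<open>Surjectivity matters because \<open>psi\<close> decodes with \<open>the_inv_into\<close>, which is one fixed junk value outside
  the range of the encoder.\<close>

lemma linear_code_encoder_surj:
  fixes C :: "'f::{field,finite} vec set"
  assumes code: "linear_code N k d C"
    and lin: "linear_map class_ring (module_vec TYPE('f) k) (code_space N C) enc"
    and inj: "inj_on enc (carrier_vec k)"
  shows "enc ` carrier_vec k = C"
proof -
  interpret linear_map class_ring "module_vec TYPE('f) k" "code_space N C" enc by (rule lin)
  interpret K: vec_space "TYPE('f)" k .
  have sub: "VectorSpace.subspace class_ring C (module_vec TYPE('f) N)"
    and dim: "vectorspace.dim class_ring (code_space N C) = k"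
    using code unfolding linear_code_def by auto
  interpret N: vec_space "TYPE('f)" N .
  have C: "C \<subseteq> carrier_vec N" using sub unfolding VectorSpace.subspace_def submodule_def
    by (simp add: module_vec_simps)
  have fC: "finite C" by (rule finite_subset[OF C finite_carrier_vec])
  \<comment> \<open>The code is finite over a finite field and generates itself, which gives finite
    dimension.\<close>
  have "W.module.gen_set (carrier (code_space N C))"
    using W.module.span_is_subset2[of C] W.module.in_own_span[of C] by simp
  then have "W.fin_dim" unfolding W.fin_dim_def using fC by (intro exI[of _ C]) simp
  then show ?thesis
    using inj_dim_eq_imp_surj[OF K.fin_dim] inj dim K.dim_is_n by (simp add: module_vec_simps)
qed

lemma linear_code_min_distance:
  assumes "linear_code N k d C" "x \<in> C" "y \<in> C" "x \<noteq> y"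
  shows "d \<le> hamming_dist {..<N} (($) x) (($) y)"
proof -
  have "d = min_distance (\<lambda>x y. hamming_dist {..<N} (($) x) (($) y)) C"
    using assms(1) by (simp add: linear_code_def)
  also have "\<dots> \<le> hamming_dist {..<N} (($) x) (($) y)"
    unfolding min_distance_def using assms by (intro cInf_lower) auto
  finally show ?thesis .
qed

section \<open>Distance of graph codes\<close>

context regular_connected_graph
begin

text \<open>Positions in the block correspond bijectively to neighbours of \<open>u\<close>. This
  turns distances in the constituent codes into counts of edges.\<close>

lemma hamming_dist_sub_block:
  assumes u: "u \<in> V"
  shows "hamming_dist {..<\<Delta>} (($) (sub_block E c u)) (($) (sub_block E c' u)) =
    card {v. {u, v} \<in> E \<and> c {u, v} \<noteq> c' {u, v}}"
proof -
  let ?N = "{v. {u, v} \<in> E}"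
  let ?ns = "sorted_list_of_set ?N"
  have fin: "finite ?N" by (rule finite_subset[OF _ finite_V]) (use edge_endpoints in auto)
  have len: "length ?ns = \<Delta>" using card_neighbours[OF u] by simp
  have bij: "bij_betw ((!) ?ns) {..<\<Delta>} ?N" using fin len by (intro bij_betw_nth) auto
  have nth: "sub_block E z u $ i = z {u, ?ns ! i}" if "i < \<Delta>" for z i
    using that len by (simp add: sub_block_def vec_of_list_index)
  let ?I = "{i \<in> {..<\<Delta>}. sub_block E c u $ i \<noteq> sub_block E c' u $ i}"
  have "?I = {i \<in> {..<\<Delta>}. c {u, ?ns ! i} \<noteq> c' {u, ?ns ! i}}"
    by (intro Collect_cong conj_cong refl) (simp add: nth)
  then have "(!) ?ns ` ?I = {v \<in> (!) ?ns ` {..<\<Delta>}. c {u, v} \<noteq> c' {u, v}}" by auto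
  then have "(!) ?ns ` ?I = {v. {u, v} \<in> E \<and> c {u, v} \<noteq> c' {u, v}}"
    unfolding bij_betw_imp_surj_on[OF bij] by simp
  moreover have "inj_on ((!) ?ns) ?I"
    using bij_betw_imp_inj_on[OF bij] by (rule inj_on_subset) auto
  ultimately show ?thesis unfolding hamming_dist_def using card_image by force
qed

text \<open>Equal blocks have distance zero, leaving no differing edge at \<open>u\<close>. Applied
  to both endpoints, this places every differing edge between \<open>S\<close> and
  \<open>T\<close>.\<close>

lemma sub_block_neqI:
  assumes uv: "{u, v} \<in> E" and neq: "c {u, v} \<noteq> c' {u, v}"
  shows "sub_block E c u \<noteq> sub_block E c' u"
proof
  assume eq: "sub_block E c u = sub_block E c' u"
  have u: "u \<in> V" using edge_endpoints[OF uv] by simp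
  have "finite {v. {u, v} \<in> E \<and> c {u, v} \<noteq> c' {u, v}}"
    by (rule finite_subset[OF _ finite_V]) (use edge_endpoints in auto)
  moreover have "card {v. {u, v} \<in> E \<and> c {u, v} \<noteq> c' {u, v}} = 0"
    using hamming_dist_sub_block[OF u, of c c'] eq by (simp add: hamming_dist_def)
  ultimately show False using uv neq by auto
qed

text \<open>Each block at a vertex of \<open>S\<close> contributes at least \<open>d\<close>
  differing edges, all ending in \<open>T\<close>. Used once from each side of the
  bipartition.\<close>

lemma differing_edges_lower_bound:
  assumes code: "linear_code \<Delta> k d C" and uV: "S \<subseteq> V"
    and S: "\<And>u. u \<in> S \<Longrightarrow> sub_block E c u \<in> C \<and> sub_block E c' u \<in> C \<and> sub_block E c u \<noteq> sub_block E c' u"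
    and T: "\<And>u v. u \<in> S \<Longrightarrow> {u, v} \<in> E \<Longrightarrow> c {u, v} \<noteq> c' {u, v} \<Longrightarrow> v \<in> T"
    and fin: "finite T"
  shows "real d * card S \<le> (\<Sum>u\<in>S. \<Sum>v\<in>T. adj u v)"
proof -
  have "real d \<le> (\<Sum>v\<in>T. adj u v)" if u: "u \<in> S" for u
  proof -
    have "d \<le> card {v. {u, v} \<in> E \<and> c {u, v} \<noteq> c' {u, v}}"
      using linear_code_min_distance[OF code, of "sub_block E c u" "sub_block E c' u"] S[OF u]
        hamming_dist_sub_block[of u c c'] u uV by auto
    also have "\<dots> \<le> card (T \<inter> {v. {u, v} \<in> E})"
      using T[OF u] fin by (intro card_mono) auto
    finally show ?thesis using fin by (simp add: adj_def)
  qed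
  then have "(\<Sum>u\<in>S. real d) \<le> (\<Sum>u\<in>S. \<Sum>v\<in>T. adj u v)" by (intro sum_mono)
  then show ?thesis by (simp add: mult.commute)
qed

end

section \<open>Pairs of codewords and the minimum distance over \<open>\<Phi>\<close>\<close>

context bipartite_regular_graph
begin

text \<open>Combines the edge counts from both sides with \<open>mixing\<close>. Measuring by
  sub-blocks keeps the encoder out of the argument.\<close>

lemma graph_code_distance:
  fixes C' C'' :: "'f::field vec set" and \<theta> \<delta> :: real
  assumes code': "linear_code \<Delta> k' d' C'" and code'': "linear_code \<Delta> k'' d'' C''"
    and \<theta>: "real d' = \<theta> * \<Delta>" and \<delta>: "real d'' = \<delta> * \<Delta>"
    and c: "c \<in> graph_code V' V'' E C' C''" and c': "c' \<in> graph_code V' V'' E C' C''"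
  defines "S \<equiv> {u \<in> V'. sub_block E c u \<noteq> sub_block E c' u}"
  assumes ne: "S \<noteq> {}"
  shows "(\<delta> - \<gamma> * sqrt (\<delta> / \<theta>)) / (1 - \<gamma>) \<le> card S / n"
proof -
  define T where "T = {v \<in> V''. sub_block E c v \<noteq> sub_block E c' v}"
  have SV: "S \<subseteq> V'" "T \<subseteq> V''" by (auto simp: S_def T_def)
  have fin: "finite S" "finite T" using SV finite_parts finite_subset by auto
  have d: "d' \<ge> 1" "d'' \<ge> 1" using code' code'' by (auto simp: linear_code_def)
  then have "real d' > 0" "real d'' > 0" by simp_all
  then have pos: "\<theta> > 0" "\<delta> > 0"
    unfolding \<theta> \<delta> using degree_pos by (auto simp: zero_less_mult_iff)
  have ST: "v \<in> T" if "u \<in> S" "{u, v} \<in> E" "c {u, v} \<noteq> c' {u, v}" for u v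
    using sub_block_neqI[of v u c c'] that edge_parts[of u v] disjoint_parts
    by (auto simp: S_def T_def insert_commute)
  have TS: "u \<in> S" if "v \<in> T" "{v, u} \<in> E" "c {v, u} \<noteq> c' {v, u}" for u v
    using sub_block_neqI[of u v c c'] that edge_parts[of u v] disjoint_parts
    by (auto simp: S_def T_def insert_commute)
  let ?e = "\<Sum>u\<in>S. \<Sum>v\<in>T. adj u v"
  have e1: "real d' * card S \<le> ?e"
    using c c' SV(1) fin
    by (intro differing_edges_lower_bound[OF code', of S c c' T] ST) (auto simp: graph_code_def S_def)
  have "real d'' * card T \<le> (\<Sum>v\<in>T. \<Sum>u\<in>S. adj v u)"
    using c c' SV(2) fin
    by (intro differing_edges_lower_bound[OF code'', of T c c' S] TS) (auto simp: graph_code_def T_def)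
  also have "\<dots> = ?e" by (subst sum.swap) (simp add: adj_commute)
  finally have e2: "real d'' * card T \<le> ?e" .
  have "real d' * card S > 0" using d ne fin by (simp add: card_gt_0_iff)
  \<comment> \<open>By \<open>e1\<close> the edge count is positive, whereas an empty
    \<open>T\<close> would make it zero.\<close>
  then have T: "T \<noteq> {}" using e1 by auto
  define \<sigma> where "\<sigma> = card S / n"
  define \<tau> where "\<tau> = card T / n"
  have st: "\<sigma> > 0" "\<tau> > 0" using ne T fin n_gt_1 by (auto simp: \<sigma>_def \<tau>_def card_gt_0_iff)
  have Dn: "real \<Delta> * n > 0" using degree_pos n_gt_1 by simp
  let ?r = "(1 - \<gamma>) * (\<sigma> * \<tau>) + \<gamma> * sqrt (\<sigma> * \<tau>)"
  have mix: "?e \<le> (\<Delta> * n) * ?r"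
    using mixing[OF SV(1) ne SV(2) T] by (simp add: \<sigma>_def \<tau>_def)
  have "(\<Delta> * n) * (\<theta> * \<sigma>) \<le> (\<Delta> * n) * ?r"
    using e1 mix n_gt_1 unfolding \<theta> \<sigma>_def by (simp add: mult_ac)
  then have 1: "\<theta> * \<sigma> \<le> ?r" using Dn by (simp only: mult_le_cancel_left_pos of_nat_mult)
  have "(\<Delta> * n) * (\<delta> * \<tau>) \<le> (\<Delta> * n) * ?r"
    using e2 mix n_gt_1 unfolding \<delta> \<tau>_def by (simp add: mult_ac)
  then have 2: "\<delta> * \<tau> \<le> ?r" using Dn by (simp only: mult_le_cancel_left_pos of_nat_mult)
  show ?thesis
    using expander_distance_arith[OF st pos graph_gamma_nonneg graph_gamma_less_1 1 2]
    by (simp add: \<sigma>_def)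
qed

text \<open>With two distinct codewords the infimum of naturals is attained by some pair, to which
  \<open>graph_code_distance\<close> applies.\<close>

lemma rel_min_distance_graph_code_Phi:
  fixes C' C'' :: "'f::{field,finite} vec set" and \<theta> \<delta> :: real
  assumes code': "linear_code \<Delta> k' d' C'" and code'': "linear_code \<Delta> k'' d'' C''"
    and \<theta>: "real d' = \<theta> * \<Delta>" and \<delta>: "real d'' = \<delta> * \<Delta>"
    and enc: "linear_map class_ring (module_vec TYPE('f) k') (code_space \<Delta> C') enc"
    and inj: "inj_on enc (carrier_vec k')"
  defines "C\<Phi> \<equiv> graph_code_Phi V' V'' E C' C'' k' enc"
  assumes two: "\<exists>x\<in>C\<Phi>. \<exists>y\<in>C\<Phi>. x \<noteq> y"
  shows "(\<delta> - \<gamma> * sqrt (\<delta> / \<theta>)) / (1 - \<gamma>) \<le> rel_min_distance V' C\<Phi>"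
proof -
  have surj: "enc ` carrier_vec k' = C'" by (rule linear_code_encoder_surj[OF code' enc inj])
  let ?D = "{hamming_dist V' x y | x y. x \<in> C\<Phi> \<and> y \<in> C\<Phi> \<and> x \<noteq> y}"
  have "?D \<noteq> {}" using two by auto
  then have "Inf ?D \<in> ?D" by (rule Inf_nat_def1)
  then obtain x y where xy: "x \<in> C\<Phi>" "y \<in> C\<Phi>" "x \<noteq> y"
    and m: "min_distance (hamming_dist V') C\<Phi> = hamming_dist V' x y"
    unfolding min_distance_def by auto
  obtain c c' where c: "c \<in> graph_code V' V'' E C' C''" "x = psi V' E k' enc c"
    and c': "c' \<in> graph_code V' V'' E C' C''" "y = psi V' E k' enc c'"
    using xy unfolding C\<Phi>_def graph_code_Phi_def by auto
  let ?S = "{u \<in> V'. sub_block E c u \<noteq> sub_block E c' u}"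
  \<comment> \<open>Decoding is injective on the range of \<open>enc\<close>, which is all of
    \<open>C'\<close>, so coordinates differ exactly where sub-blocks do.\<close>
  have neq: "x u \<noteq> y u \<longleftrightarrow> sub_block E c u \<noteq> sub_block E c' u" if u: "u \<in> V'" for u
  proof -
    have "sub_block E c u \<in> C'" "sub_block E c' u \<in> C'" using c c' u by (auto simp: graph_code_def)
    then show ?thesis
      using inj_on_eq_iff[OF inj_on_the_inv_into[OF inj], unfolded surj] u
      unfolding c c' psi_def by simp
  qed
  have dist: "hamming_dist V' x y = card ?S"
    unfolding hamming_dist_def using neq by (intro arg_cong[of _ _ card]) auto
  obtain u where "x u \<noteq> y u" using xy(3) by (auto simp: fun_eq_iff)
  \<comment> \<open>Outside \<open>V'\<close> both words take the default value
    \<open>undefined\<close>, so they cannot differ there.\<close>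
  then have "u \<in> V'" unfolding c c' psi_def by (auto split: if_splits)
  then have "?S \<noteq> {}" using neq \<open>x u \<noteq> y u\<close> by auto
  from graph_code_distance[OF code' code'' \<theta> \<delta> c(1) c'(1) this]
  show ?thesis unfolding rel_min_distance_def m dist card_V' .
qed

end

theorem theorem3p1:
  fixes V' V'' :: "'v::linorder set" and E :: "'v set set"
    and C' C'' :: "'f::{field,finite} vec set"
    and enc :: "'f vec \<Rightarrow> 'f vec"
    and n \<Delta> k' k'' d' d'' :: nat
    and r \<theta> R \<delta> :: real
  assumes "bipartite_graph V' V'' E"
    and "regular_graph (V' \<union> V'') E \<Delta>"
    and "connected_graph (V' \<union> V'') E"
    and "card V' = n" and "card V'' = n" and "n > 1"
    and "linear_code \<Delta> k' d' C'"
    and "real k' = r * real \<Delta>" and "real d' = \<theta> * real \<Delta>"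
    and "linear_code \<Delta> k'' d'' C''"
    and "real k'' = R * real \<Delta>" and "real d'' = \<delta> * real \<Delta>"
    and "linear_map class_ring (module_vec TYPE('f) k') (code_space \<Delta> C') enc"
    and "inj_on enc (carrier_vec k')"
  defines "\<gamma> \<equiv> graph_gamma (V' \<union> V'') E \<Delta>"
    and "C\<Phi> \<equiv> graph_code_Phi V' V'' E C' C'' k' enc"
  shows "((\<exists>x\<in>C\<Phi>. \<exists>y\<in>C\<Phi>. x \<noteq> y) \<longrightarrow>
           rel_min_distance V' C\<Phi> \<ge> (\<delta> - \<gamma> * sqrt (\<delta> / \<theta>)) / (1 - \<gamma>)) \<and>
         ((\<lambda>g. (\<delta> - g * sqrt (\<delta> / \<theta>)) / (1 - g)) \<longlongrightarrow> \<delta>) (at 0)"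
proof (intro conjI impI)
  \<comment> \<open>Degree zero would force \<open>d' = 0\<close>, but a linear code has
    \<open>1 \<le> d'\<close>.\<close>
  have "\<Delta> > 0" using assms(7,9) by (cases "\<Delta> = 0") (auto simp: linear_code_def)
  then interpret bipartite_regular_graph V' V'' E \<Delta> n
    using assms(1-6) by unfold_locales
  assume "\<exists>x\<in>C\<Phi>. \<exists>y\<in>C\<Phi>. x \<noteq> y"
  then show "rel_min_distance V' C\<Phi> \<ge> (\<delta> - \<gamma> * sqrt (\<delta> / \<theta>)) / (1 - \<gamma>)"
    using rel_min_distance_graph_code_Phi[OF assms(7,10,9,12,13,14)]
    unfolding \<gamma>_def C\<Phi>_def by blast
next
  show "((\<lambda>g. (\<delta> - g * sqrt (\<delta> / \<theta>)) / (1 - g)) \<longlongrightarrow> \<delta>) (at 0)"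
    \<comment> \<open>The bound is continuous in \<open>g\<close> at 0, where its denominator is 1
      and its value \<open>\<delta>\<close>.\<close>
    by (auto intro!: tendsto_eq_intros)
qed

end
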